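(* Consider the static channel with constant channel power gain $G$ described in the context, and let $G$ vary with all other parameters fixed. When $G$ increases, the following claims are true: (1) $\mathcal{E}^\star$ strictly decreases. (2) $s^\star$ strictly increases. Moreover, $\lim_{G\to+\infty}s^\star=s_2$ and $\lim_{G\to0}s^\star=0$, where $s_2$ satisfies $\kappa\, g(Bs_2)=P_c$.
   Context: Constants: bandwidth $B$ (Hz), noise variance $\sigma^2$, power-amplifier efficiency $\xi$, rate-independent circuit power $P_c>0$, coefficient $\kappa\ge 0$. The function $\phi(R)$, $R\ge0$, satisfies $\phi(0)=0$ and is differentiable, strictly increasing and (not necessarily strictly) convex of $R\ge0$. For $s\ge0$ let $\rho(s)=\min\{p\ge0:\log_2(1+Gp)\ge s\}=\frac1G(2^s-1)$ (minimum transmission power needed to achieve spectral efficiency $s$, divided by $\sigma^2$, for the static channel with gain $G$ known at the transmitter). Minimum total power: $P(s)=\kappa\phi(Bs)+\frac{\sigma^2}{\xi}\rho(s)+P_c$. Energy per bit (the energy efficiency; smaller is better): $\mathcal{E}(s)=\frac{P(s)}{Bs}$, which is $+\infty$ at $s=0$. The optimum value is $\mathcal{E}^\star=\min_{s\ge0}\mathcal{E}(s)$ and $s^\star=\arg\min_{s\ge0}\mathcal{E}(s)$ is the (unique) minimizer; both are regarded as functions of the parameters. Finally $g(R)=R\phi'(R)-\phi(R)$, where a prime denotes the derivative.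
   Formalization: The limit of s* as G→+∞ is a solution s_2 of κg(Bs_2)=P_c (some solution, if there are several) only when the equation is solvable; when it has no solution (e.g. κ=0 or φ linear), s* is shown to tend to +∞ instead. *)

theory Defs
  imports "HOL-Analysis.Analysis"
begin

(* LEAST denotes the attained minimum; in closed form the value is (2 powr s - 1) / G. *)
definition rho :: "real \<Rightarrow> real \<Rightarrow> real" where
  "rho G s = (LEAST p. p \<ge> 0 \<and> log 2 (1 + G * p) \<ge> s)"

definition total_power ::
  "(real \<Rightarrow> real) \<Rightarrow> real \<Rightarrow> real \<Rightarrow> real \<Rightarrow> real \<Rightarrow> real \<Rightarrow> real \<Rightarrow> real \<Rightarrow> real" where
  "total_power \<phi> \<kappa> B \<sigma> \<xi> Pc G s = \<kappa> * \<phi> (B * s) + \<sigma>\<^sup>2 / \<xi> * rho G s + Pc"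

(* Extended real values, since the energy per bit is infinite at s = 0. *)
definition energy_per_bit ::
  "(real \<Rightarrow> real) \<Rightarrow> real \<Rightarrow> real \<Rightarrow> real \<Rightarrow> real \<Rightarrow> real \<Rightarrow> real \<Rightarrow> real \<Rightarrow> ereal" where
  "energy_per_bit \<phi> \<kappa> B \<sigma> \<xi> Pc G s =
     (if s = 0 then \<infinity> else ereal (total_power \<phi> \<kappa> B \<sigma> \<xi> Pc G s / (B * s)))"

definition opt_energy ::
  "(real \<Rightarrow> real) \<Rightarrow> real \<Rightarrow> real \<Rightarrow> real \<Rightarrow> real \<Rightarrow> real \<Rightarrow> real \<Rightarrow> ereal" where
  "opt_energy \<phi> \<kappa> B \<sigma> \<xi> Pc G =
     (LEAST e. e \<in> energy_per_bit \<phi> \<kappa> B \<sigma> \<xi> Pc G ` {0..})"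

definition opt_s ::
  "(real \<Rightarrow> real) \<Rightarrow> real \<Rightarrow> real \<Rightarrow> real \<Rightarrow> real \<Rightarrow> real \<Rightarrow> real \<Rightarrow> real" where
  "opt_s \<phi> \<kappa> B \<sigma> \<xi> Pc G =
     (THE s. is_arg_min (energy_per_bit \<phi> \<kappa> B \<sigma> \<xi> Pc G) (\<lambda>s. s \<ge> 0) s)"

(* The derivative is taken within {0..}, hence one-sided at 0, because the values of \<phi> on
   negative arguments are irrelevant. *)
definition g_fun :: "(real \<Rightarrow> real) \<Rightarrow> real \<Rightarrow> real" where
  "g_fun \<phi> R = R * vector_derivative \<phi> (at R within {0..}) - \<phi> R"

end

theory Submission
  imports Defs "HOL-Real_Asymp.Real_Asymp"
begin

text \<open>
  With \<open>c = \<sigma>\<^sup>2 / (\<xi> G)\<close>, the derivative of the energy per bit at \<open>s > 0\<close> has the sign of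
  \<open>\<kappa> g(B s) + c q(s) - P\<^sub>c\<close>, where \<open>q(s) = s r'(s) - r(s)\<close> for \<open>r(s) = 2\<^sup>s - 1\<close>. Convexity makes
  \<open>g\<close> nondecreasing and, together with differentiability, continuous, while \<open>q\<close> is strictly
  increasing and unbounded; so \<open>s\<^sup>\<star>\<close> is the unique root of \<open>\<kappa> g(B s) + c q(s) = P\<^sub>c\<close>. Comparing
  the sign of the left-hand side minus \<open>P\<^sub>c\<close> at a given point with that at the root yields
  all claims about \<open>s\<^sup>\<star>\<close>.
\<close>

section \<open>Differentiable convex functions on the half-line\<close>

lemma has_real_derivative_vector_derivative_nonneg:
  fixes f :: "real \<Rightarrow> real"
  assumes "f differentiable_on {0..}" "x > 0"
  shows "(f has_real_derivative vector_derivative f (at x within {0..})) (at x)"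
proof -
  have "f differentiable (at x within {0..})"
    using assms by (auto simp: differentiable_on_def)
  hence "(f has_real_derivative vector_derivative f (at x within {0..})) (at x within {0..})"
    by (simp add: vector_derivative_works has_real_derivative_iff_has_vector_derivative)
  moreover have "at x within {0..} = at x"
    using assms(2) by (intro at_within_interior) simp
  ultimately show ?thesis by simp
qed

lemma convex_tangent_nonneg:
  fixes f :: "real \<Rightarrow> real"
  assumes "f differentiable_on {0..}" "convex_on {0..} f" "x > 0" "y \<ge> 0"
  shows "vector_derivative f (at x within {0..}) * (y - x) \<le> f y - f x"
proof (rule convex_on_imp_above_tangent[OF assms(2)])
  show "(f has_real_derivative vector_derivative f (at x within {0..})) (at x within {0..})"
    using has_real_derivative_vector_derivative_nonneg[OF assms(1,3)]
    by (rule has_field_derivative_at_within)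
qed (use assms in auto)

text \<open>The tangent at \<open>y\<close>, evaluated at \<open>x\<close>, bounds the increment of
  g below by \<open>x * (D y - D x)\<close>. For \<open>x > 0\<close>, adding the tangent
  inequalities at both points gives \<open>D x \<le> D y\<close>; for \<open>x = 0\<close>, the
  factor \<open>x\<close> vanishes.\<close>

lemma g_fun_mono:
  assumes "\<phi> differentiable_on {0..}" "convex_on {0..} \<phi>"
  shows "mono_on {0..} (g_fun \<phi>)"
proof (rule mono_onI)
  fix x y :: real
  assume xy: "x \<in> {0..}" "y \<in> {0..}" "x \<le> y"
  define D where "D x = vector_derivative \<phi> (at x within {0..})" for x
  have tangent: "D x * (y - x) \<le> \<phi> y - \<phi> x" if "x > 0" "y \<ge> 0" for x y
    using convex_tangent_nonneg[OF assms that] by (simp add: D_def)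
  show "g_fun \<phi> x \<le> g_fun \<phi> y"
  proof (cases "x = y")
    case False
    hence "y > 0" using xy by auto
    have y: "D y * (x - y) \<le> \<phi> x - \<phi> y"
      using tangent[of y x] \<open>y > 0\<close> xy by auto
    have "0 \<le> x * (D y - D x)"
    proof (cases "x = 0")
      case False
      hence "D x * (y - x) \<le> \<phi> y - \<phi> x" using tangent[of x y] xy by auto
      with y have "(D y - D x) * (y - x) \<ge> 0" by (simp add: algebra_simps)
      thus ?thesis using \<open>x \<noteq> y\<close> xy by (simp add: zero_le_mult_iff)
    qed simp
    with y show ?thesis unfolding g_fun_def D_def[symmetric] by (simp add: algebra_simps)
  qed simp
qed

text \<open>
  For \<open>\<lambda> \<noteq> 1\<close> put \<open>k \<lambda> y = (\<phi> (\<lambda> y) - \<phi> y) / (\<lambda> - 1)\<close>. By convexity, \<open>y \<phi>' y\<close> lies below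
  \<open>k \<lambda> y\<close> for \<open>\<lambda> > 1\<close> and above it for \<open>\<lambda> < 1\<close>. Since \<open>k \<lambda>\<close> is continuous and
  \<open>k \<lambda> x \<longrightarrow> x \<phi>' x\<close> as \<open>\<lambda> \<longrightarrow> 1\<close>, this squeezes \<open>y \<phi>' y\<close> near \<open>x\<close>; scaling instead of
  translating keeps the points in \<open>{0..}\<close>, so that \<open>x = 0\<close> is not special.
\<close>

lemma g_fun_continuous:
  assumes diff: "\<phi> differentiable_on {0..}" and conv: "convex_on {0..} \<phi>"
  shows "continuous_on {0..} (g_fun \<phi>)"
proof -
  define D where "D x = vector_derivative \<phi> (at x within {0..})" for x
  define k where "k l y = (\<phi> (l * y) - \<phi> y) / (l - 1)" for l y :: real
  have cont: "continuous_on {0..} \<phi>" using diff by (rule differentiable_imp_continuous_on)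
  have k_cont: "continuous_on {0..} (k l)" if "l > 0" "l \<noteq> 1" for l
    unfolding k_def using that
    by (intro continuous_intros continuous_on_compose2[OF cont] cont) auto
  have tangent: "y * D y * (l - 1) \<le> \<phi> (l * y) - \<phi> y" if "l > 0" "y \<ge> 0" for l y
  proof (cases "y = 0")
    case False
    thus ?thesis using convex_tangent_nonneg[OF diff conv, of y "l * y"] that
      by (simp add: D_def algebra_simps)
  qed simp
  have k_upper: "y * D y \<le> k l y" if "l > 1" "y \<ge> 0" for l y
    using tangent[of l y] that by (simp add: k_def field_simps)
  have k_lower: "k l y \<le> y * D y" if "0 < l" "l < 1" "y \<ge> 0" for l y
    using tangent[of l y] that by (simp add: k_def field_simps)
  have k_lim: "((\<lambda>l. k l x) \<longlongrightarrow> x * D x) (at 1)" if "x \<ge> 0" for x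
  proof (cases "x = 0")
    case False
    hence "(\<phi> has_real_derivative D x) (at (1 * x))"
      unfolding D_def using has_real_derivative_vector_derivative_nonneg[OF diff] that by auto
    hence "((\<lambda>l. \<phi> (l * x)) has_real_derivative D x * x) (at 1)"
      by (rule DERIV_chain2) (auto intro!: derivative_eq_intros)
    thus ?thesis by (simp add: has_field_derivative_iff k_def mult.commute)
  qed (simp add: k_def)
  have "((\<lambda>y. y * D y) \<longlongrightarrow> x * D x) (at x within {0..})" if x: "x \<ge> 0" for x
  proof (rule order_tendstoI)
    fix a assume a: "a < x * D x"
    have "eventually (\<lambda>l. a < k l x) (at_left 1)"
      using order_tendstoD(1)[OF k_lim[OF x] a] by (rule filter_leD[OF at_le, rotated]) simp
    moreover have "eventually (\<lambda>l::real. l \<in> {0<..<1}) (at_left 1)"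
      by (intro eventually_at_leftI[of 0]) auto
    ultimately have "eventually (\<lambda>l. a < k l x \<and> l \<in> {0<..<1}) (at_left 1)"
      by eventually_elim auto
    \<comment> \<open>One such \<open>l\<close> is fixed before \<open>y\<close> varies, so
      continuity of the single function \<open>k l\<close> suffices.\<close>
    then obtain l where l: "a < k l x" "0 < l" "l < 1"
      using eventually_happens[of _ "at_left (1::real)"] by auto
    have "(k l \<longlongrightarrow> k l x) (at x within {0..})"
      using k_cont[of l] l x by (auto simp: continuous_on_def)
    hence "eventually (\<lambda>y. a < k l y) (at x within {0..})" using l(1) by (rule order_tendstoD)
    moreover have "eventually (\<lambda>y. y \<in> {0..}) (at x within {0..})"
      by (auto simp: eventually_at_filter)
    ultimately show "eventually (\<lambda>y. a < y * D y) (at x within {0..})"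
      by eventually_elim (use k_lower[of l] l in force)
  next
    fix a assume a: "x * D x < a"
    have "eventually (\<lambda>l. k l x < a) (at_right 1)"
      using order_tendstoD(2)[OF k_lim[OF x] a] by (rule filter_leD[OF at_le, rotated]) simp
    moreover have "eventually (\<lambda>l::real. 1 < l) (at_right 1)"
      by (rule eventually_at_right_less)
    ultimately have "eventually (\<lambda>l. k l x < a \<and> 1 < l) (at_right 1)"
      by eventually_elim auto
    then obtain l where l: "k l x < a" "1 < l"
      using eventually_happens[of _ "at_right (1::real)"] by auto
    have "(k l \<longlongrightarrow> k l x) (at x within {0..})"
      using k_cont[of l] l x by (auto simp: continuous_on_def)
    hence "eventually (\<lambda>y. k l y < a) (at x within {0..})" using l(1) by (rule order_tendstoD)
    moreover have "eventually (\<lambda>y. y \<in> {0..}) (at x within {0..})"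
      by (auto simp: eventually_at_filter)
    ultimately show "eventually (\<lambda>y. y * D y < a) (at x within {0..})"
      by eventually_elim (use k_upper[of l] l in force)
  qed
  hence "continuous_on {0..} (\<lambda>y. y * D y)" by (simp add: continuous_on_def)
  hence "continuous_on {0..} (\<lambda>y. y * D y - \<phi> y)" using cont by (rule continuous_on_diff)
  thus ?thesis by (simp add: g_fun_def D_def)
qed

section \<open>The transmission power\<close>

definition q_exp :: "real \<Rightarrow> real" where
  "q_exp s = s * (ln 2 * 2 powr s) - (2 powr s - 1)"

lemma q_exp_0 [simp]: "q_exp 0 = 0"
  by (simp add: q_exp_def)

lemma q_exp_continuous: "continuous_on A q_exp"
  unfolding q_exp_def by (intro continuous_intros) auto

text \<open>The r' terms in the derivative of s r'(s) - r(s) cancel, leaving s r''(s) > 0 for s >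
  0.\<close>

lemma q_exp_strict_mono: "strict_mono_on {0..} q_exp"
proof (rule strict_mono_onI)
  fix x y :: real
  assume "x \<in> {0..}" "y \<in> {0..}" "x < y"
  show "q_exp x < q_exp y"
  proof (rule DERIV_pos_imp_increasing_open[OF \<open>x < y\<close>])
    fix z assume "x < z" "z < y"
    with \<open>x \<in> {0..}\<close> have "z > 0" by simp
    have "(q_exp has_real_derivative z * (ln 2)\<^sup>2 * 2 powr z) (at z)"
      unfolding q_exp_def
      by (auto intro!: derivative_eq_intros simp: powr_def power2_eq_square)
    moreover have "z * (ln 2)\<^sup>2 * 2 powr z > 0" using \<open>z > 0\<close> by simp
    ultimately show "\<exists>d. (q_exp has_real_derivative d) (at z) \<and> d > 0" by blast
  qed (rule q_exp_continuous)
qed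

lemma q_exp_pos: "s > 0 \<Longrightarrow> q_exp s > 0"
  using strict_mono_onD[OF q_exp_strict_mono, of 0 s] by simp

lemma q_exp_at_top: "filterlim q_exp at_top at_top"
  unfolding q_exp_def by real_asymp

lemma rho_eq:
  assumes "G > 0" "s \<ge> 0"
  shows "rho G s = (2 powr s - 1) / G"
  unfolding rho_def
proof (rule Least_equality)
  have "2 powr s \<ge> 1" using assms by (simp add: ge_one_powr_ge_zero)
  thus "0 \<le> (2 powr s - 1) / G \<and> s \<le> log 2 (1 + G * ((2 powr s - 1) / G))"
    using assms by simp
next
  fix p assume p: "0 \<le> p \<and> s \<le> log 2 (1 + G * p)"
  have "1 + G * p > 0" using assms p by (simp add: add_pos_nonneg)
  hence "2 powr s \<le> 1 + G * p" using p by (simp add: le_log_iff)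
  thus "(2 powr s - 1) / G \<le> p" using assms by (simp add: field_simps)
qed

section \<open>The optimal spectral efficiency\<close>

locale static_channel =
  fixes \<phi> :: "real \<Rightarrow> real" and \<kappa> B \<sigma> \<xi> Pc :: real
  assumes B: "B > 0" and \<sigma>: "\<sigma> > 0" and \<xi>: "\<xi> > 0" and Pc: "Pc > 0" and \<kappa>: "\<kappa> \<ge> 0"
    and \<phi>_0: "\<phi> 0 = 0"
    and \<phi>_diff: "\<phi> differentiable_on {0..}"
    and \<phi>_convex: "convex_on {0..} \<phi>"
begin

abbreviation "\<E> \<equiv> energy_per_bit \<phi> \<kappa> B \<sigma> \<xi> Pc"
abbreviation "\<E>opt \<equiv> opt_energy \<phi> \<kappa> B \<sigma> \<xi> Pc"
abbreviation "sopt \<equiv> opt_s \<phi> \<kappa> B \<sigma> \<xi> Pc"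

section \<open>Stationarity condition\<close>

definition \<gamma> :: "real \<Rightarrow> real" where "\<gamma> s = \<kappa> * g_fun \<phi> (B * s)"

definition c :: "real \<Rightarrow> real" where "c G = \<sigma>\<^sup>2 / (\<xi> * G)"

lemma c_pos: "G > 0 \<Longrightarrow> c G > 0"
  using \<sigma> \<xi> by (simp add: c_def)

lemma c_strict_antimono: "0 < G \<Longrightarrow> G < G' \<Longrightarrow> c G' < c G"
  unfolding c_def using \<sigma> \<xi> by (intro divide_strict_left_mono) auto

lemma c_tendsto_0: "(c \<longlongrightarrow> 0) at_top"
  unfolding c_def using \<sigma> \<xi> by real_asymp

lemma c_at_top: "filterlim c at_top (at_right 0)"
  unfolding c_def using \<sigma> \<xi> by real_asymp

lemma \<gamma>_0: "\<gamma> 0 = 0"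
  by (simp add: \<gamma>_def g_fun_def \<phi>_0)

lemma \<gamma>_mono: "0 \<le> x \<Longrightarrow> x \<le> y \<Longrightarrow> \<gamma> x \<le> \<gamma> y"
  unfolding \<gamma>_def using B \<kappa>
  by (intro mult_left_mono mono_onD[OF g_fun_mono[OF \<phi>_diff \<phi>_convex]]) auto

lemma \<gamma>_nonneg: "0 \<le> x \<Longrightarrow> 0 \<le> \<gamma> x"
  using \<gamma>_mono[of 0 x] \<gamma>_0 by simp

lemma \<gamma>_continuous: "continuous_on {0..} \<gamma>"
  unfolding \<gamma>_def using B
  by (intro continuous_intros continuous_on_compose2[OF g_fun_continuous[OF \<phi>_diff \<phi>_convex]])
     auto

text \<open>Up to the positive factor 1/(B s^2), this is the derivative of the energy per bit at s >
  0.\<close>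

definition h :: "real \<Rightarrow> real \<Rightarrow> real" where "h G s = \<gamma> s + c G * q_exp s - Pc"

lemma h_strict_mono:
  assumes "G > 0" "0 \<le> x" "x < y"
  shows "h G x < h G y"
proof -
  have "c G * q_exp x < c G * q_exp y"
    using assms c_pos strict_mono_onD[OF q_exp_strict_mono, of x y] by simp
  thus ?thesis using \<gamma>_mono[of x y] assms by (simp add: h_def)
qed

lemma h_strict_antimono_gain: "0 < G \<Longrightarrow> G < G' \<Longrightarrow> 0 < s \<Longrightarrow> h G' s < h G s"
  using c_strict_antimono[of G G'] q_exp_pos[of s] by (simp add: h_def)

text \<open>Intermediate value theorem: \<open>h G 0 = -Pc\<close>, and since
  \<open>\<gamma>\<close> is nonnegative, the unbounded term \<open>c G * q_exp s\<close> alone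
  lifts \<open>h G\<close> to zero or above.\<close>

lemma h_root_exists:
  assumes "G > 0"
  shows "\<exists>s>0. h G s = 0"
proof -
  have "eventually (\<lambda>s. q_exp s \<ge> Pc / c G \<and> s \<ge> 0) at_top"
    using q_exp_at_top eventually_ge_at_top[of 0]
    by (auto simp: filterlim_at_top intro: eventually_conj)
  then obtain M where M: "q_exp M \<ge> Pc / c G" "M \<ge> 0"
    using eventually_happens[of _ "at_top :: real filter"] by auto
  have "c G * q_exp M \<ge> Pc" using M c_pos[OF assms] by (simp add: field_simps)
  hence "h G M \<ge> 0" using \<gamma>_nonneg[of M] M by (simp add: h_def)
  moreover have h0: "h G 0 < 0" using Pc by (simp add: h_def \<gamma>_0)
  moreover have "continuous_on {0..M} (h G)"
    unfolding h_def
    by (intro continuous_intros continuous_on_subset[OF \<gamma>_continuous] q_exp_continuous) auto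
  ultimately obtain s where "0 \<le> s" "h G s = 0" using IVT'[of "h G" 0 0 M] M by auto
  moreover have "s \<noteq> 0" using h0 \<open>h G s = 0\<close> by auto
  ultimately show ?thesis by (intro exI[of _ s]) auto
qed

section \<open>Derivative and minimum of the energy per bit\<close>

definition avg :: "real \<Rightarrow> real \<Rightarrow> real" where
  "avg G s = (\<kappa> * \<phi> (B * s) + c G * (2 powr s - 1) + Pc) / (B * s)"

text \<open>The point 0 is excluded: there \<open>avg G\<close> is 0 by the division convention,
  while the energy is infinite.\<close>

lemma energy_per_bit_eq: "G > 0 \<Longrightarrow> s > 0 \<Longrightarrow> \<E> G s = ereal (avg G s)"
  by (simp add: energy_per_bit_def total_power_def avg_def c_def rho_eq)

lemma avg_has_derivative:
  assumes "s > 0"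
  shows "(avg G has_real_derivative h G s / (B * s\<^sup>2)) (at s)"
proof -
  define d where "d = vector_derivative \<phi> (at (B * s) within {0..})"
  have "(\<phi> has_real_derivative d) (at (B * s))"
    unfolding d_def using assms B
    by (intro has_real_derivative_vector_derivative_nonneg[OF \<phi>_diff]) auto
  hence 1: "((\<lambda>s. \<phi> (B * s)) has_real_derivative d * B) (at s)"
    by (rule DERIV_chain2) (auto intro!: derivative_eq_intros)
  have 2: "((\<lambda>s::real. 2 powr s) has_real_derivative ln 2 * 2 powr s) (at s)"
    by (auto intro!: derivative_eq_intros simp: powr_def)
  have num: "((\<lambda>s. \<kappa> * \<phi> (B * s) + c G * (2 powr s - 1) + Pc) has_real_derivative
      \<kappa> * (d * B) + c G * (ln 2 * 2 powr s)) (at s)"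
    by (rule derivative_eq_intros 1 2 refl | simp)+
  have "(avg G has_real_derivative
      ((\<kappa> * (d * B) + c G * (ln 2 * 2 powr s)) * (B * s) -
       (\<kappa> * \<phi> (B * s) + c G * (2 powr s - 1) + Pc) * B) / (B * s * (B * s))) (at s)"
    unfolding avg_def using B assms
    by (intro DERIV_divide num) (auto intro!: derivative_eq_intros)
  \<comment> \<open>The phi terms combine to g(B s) and the exponential terms to q(s), with one
    common factor \<open>B\<close>.\<close>
  moreover have "((\<kappa> * (d * B) + c G * (ln 2 * 2 powr s)) * (B * s) -
       (\<kappa> * \<phi> (B * s) + c G * (2 powr s - 1) + Pc) * B) = B * h G s"
    unfolding h_def \<gamma>_def g_fun_def q_exp_def d_def[symmetric] by (simp add: algebra_simps)
  moreover have "B * h G s / (B * s * (B * s)) = h G s / (B * s\<^sup>2)"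
    using B by (simp add: power2_eq_square)
  ultimately show ?thesis by simp
qed

lemma avg_continuous: "continuous_on {0<..} (avg G)"
  by (rule DERIV_continuous_on) (auto intro: has_field_derivative_at_within avg_has_derivative)

text \<open>Strict monotonicity makes \<open>h G\<close> negative before its root and positive after
  it, so \<open>avg G\<close> strictly falls and then strictly rises.\<close>

lemma avg_unique_min:
  assumes G: "G > 0" and s: "s > 0" "h G s = 0" and t: "t > 0" "t \<noteq> s"
  shows "avg G s < avg G t"
proof (cases "s < t")
  case True
  have "\<exists>y. (avg G has_real_derivative y) (at x) \<and> y > 0" if "s < x" for x
  proof -
    have "h G x / (B * x\<^sup>2) > 0" using h_strict_mono[OF G, of s x] s that B by simp
    thus ?thesis using avg_has_derivative[of x G] s that by force
  qed
  moreover have "continuous_on {s..t} (avg G)"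
    using s by (intro continuous_on_subset[OF avg_continuous]) auto
  ultimately show ?thesis
    using DERIV_pos_imp_increasing_open[of s t "avg G"] True by blast
next
  case False
  have "\<exists>y. (avg G has_real_derivative y) (at x) \<and> y < 0" if "0 < x" "x < s" for x
  proof -
    have "h G x / (B * x\<^sup>2) < 0"
      using h_strict_mono[OF G, of x s] s that B by (simp add: divide_neg_pos)
    thus ?thesis using avg_has_derivative[of x G] that by force
  qed
  moreover have "continuous_on {t..s} (avg G)"
    using t by (intro continuous_on_subset[OF avg_continuous]) auto
  moreover have "t < s" using False t by simp
  ultimately show ?thesis
    using DERIV_neg_imp_decreasing_open[of t s "avg G"] t(1) by (meson less_trans)
qed

lemma energy_unique_min:
  assumes "G > 0" "s > 0" "h G s = 0" "t \<ge> 0" "t \<noteq> s"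
  shows "\<E> G s < \<E> G t"
proof (cases "t = 0")
  case True
  thus ?thesis using assms by (simp add: energy_per_bit_eq) (simp add: energy_per_bit_def)
next
  case False
  thus ?thesis using assms avg_unique_min[of G s t] by (simp add: energy_per_bit_eq)
qed

text \<open>Replaces the definite description by the root of \<open>h G\<close>; the strict
  inequality gives both minimality and uniqueness.\<close>

lemma opt_s_eq_root:
  assumes "G > 0" "s > 0" "h G s = 0"
  shows "sopt G = s"
  unfolding opt_s_def
proof (rule the_equality)
  show "is_arg_min (\<E> G) (\<lambda>s. s \<ge> 0) s"
    using energy_unique_min[OF assms] assms(2) unfolding is_arg_min_def
    by (metis less_imp_le not_less_iff_gr_or_eq)
next
  fix t assume "is_arg_min (\<E> G) (\<lambda>s. s \<ge> 0) t"
  thus "t = s"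
    using energy_unique_min[OF assms, of t] assms(2) by (auto simp: is_arg_min_def)
qed

lemma opt_s_root:
  assumes "G > 0"
  shows "sopt G > 0" "h G (sopt G) = 0"
  using h_root_exists[OF assms] opt_s_eq_root[OF assms] by auto

lemma opt_energy_eq:
  assumes "G > 0"
  shows "\<E>opt G = \<E> G (sopt G)"
  unfolding opt_energy_def
proof (rule Least_equality)
  show "\<E> G (sopt G) \<in> \<E> G ` {0..}" using opt_s_root(1)[OF assms] by auto
  show "\<E> G (sopt G) \<le> e" if "e \<in> \<E> G ` {0..}" for e
    using that energy_unique_min[OF assms opt_s_root[OF assms]] by force
qed

lemma opt_s_greater_iff:
  assumes "G > 0" "x \<ge> 0"
  shows "x < sopt G \<longleftrightarrow> h G x < 0"
  using h_strict_mono[OF assms(1), of x "sopt G"] h_strict_mono[OF assms(1), of "sopt G" x]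
    opt_s_root[OF assms(1)] assms(2) by (cases x "sopt G" rule: linorder_cases) auto

lemma opt_s_less_iff:
  assumes "G > 0" "x \<ge> 0"
  shows "sopt G < x \<longleftrightarrow> h G x > 0"
  using h_strict_mono[OF assms(1), of x "sopt G"] h_strict_mono[OF assms(1), of "sopt G" x]
    opt_s_root[OF assms(1)] assms(2) by (cases x "sopt G" rule: linorder_cases) auto

section \<open>Monotonicity in the gain\<close>

text \<open>Keeping the old optimal point already costs strictly less at the larger gain; optimizing
  again cannot raise the cost.\<close>

lemma opt_energy_strict_antimono: "strict_antimono_on {0<..} \<E>opt"
proof (rule monotone_onI)
  fix G G' :: real
  assume G: "G \<in> {0<..}" "G' \<in> {0<..}" "G < G'"
  have s: "sopt G > 0" using G opt_s_root by simp
  have "c G' * (2 powr sopt G - 1) < c G * (2 powr sopt G - 1)"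
    using s G c_strict_antimono[of G G'] by simp
  hence "avg G' (sopt G) < avg G (sopt G)"
    unfolding avg_def using s B by (intro divide_strict_right_mono) auto
  hence "\<E> G' (sopt G) < \<E> G (sopt G)" using s G by (simp add: energy_per_bit_eq)
  moreover have "\<E> G' (sopt G') \<le> \<E> G' (sopt G)"
    using energy_unique_min[of G' "sopt G'" "sopt G"] opt_s_root[of G'] G s
    by (cases "sopt G = sopt G'") auto
  ultimately show "\<E>opt G' < \<E>opt G" using G by (simp add: opt_energy_eq)
qed

text \<open>A larger gain makes \<open>h\<close> negative at the old root, so the new root lies
  further right.\<close>

lemma opt_s_strict_mono: "strict_mono_on {0<..} sopt"
proof (rule strict_mono_onI)
  fix G G' :: real
  assume G: "G \<in> {0<..}" "G' \<in> {0<..}" "G < G'"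
  hence "h G' (sopt G) < 0"
    using opt_s_root[of G] h_strict_antimono_gain[of G G' "sopt G"] by auto
  thus "sopt G < sopt G'" using opt_s_greater_iff[of G' "sopt G"] opt_s_root[of G] G by auto
qed

section \<open>Limits of the optimal spectral efficiency\<close>

lemma h_tendsto: "((\<lambda>G. h G x) \<longlongrightarrow> \<gamma> x - Pc) at_top"
  unfolding h_def by (auto intro!: tendsto_eq_intros c_tendsto_0)

lemma opt_s_eventually_greater:
  assumes "x \<ge> 0" "\<gamma> x < Pc"
  shows "eventually (\<lambda>G. x < sopt G) at_top"
proof -
  have "eventually (\<lambda>G. h G x < 0) at_top"
    using h_tendsto[of x] assms by (intro order_tendstoD) auto
  with eventually_gt_at_top[of 0] show ?thesis
    by eventually_elim (use assms opt_s_greater_iff in auto)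
qed

lemma opt_s_tendsto_0: "(sopt \<longlongrightarrow> 0) (at_right 0)"
proof (rule order_tendstoI)
  have pos: "eventually (\<lambda>G::real. 0 < G) (at_right 0)" by (rule eventually_at_right_less)
  show "eventually (\<lambda>G. a < sopt G) (at_right 0)" if "a < 0" for a
    using pos by eventually_elim (use opt_s_root(1) that in force)
  show "eventually (\<lambda>G. sopt G < a) (at_right 0)" if "a > 0" for a
  proof -
    \<comment> \<open>Beyond this threshold the transmission term alone exceeds \<open>Pc\<close> at
      \<open>a\<close>.\<close>
    have "eventually (\<lambda>G. Pc / q_exp a < c G) (at_right 0)"
      using c_at_top by (simp add: filterlim_at_top_dense)
    with pos show ?thesis
    proof eventually_elim
      case (elim G)
      hence "Pc < c G * q_exp a" using q_exp_pos[OF that] by (simp add: field_simps)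
      hence "h G a > 0" using \<gamma>_nonneg[of a] that by (simp add: h_def)
      thus ?case using opt_s_less_iff elim that by simp
    qed
  qed
qed

text \<open>Since \<open>\<gamma>\<close> starts at 0 and is continuous, never attaining
  \<open>Pc\<close> means staying below it, so every bound is eventually passed.\<close>

lemma opt_s_at_top:
  assumes "\<nexists>s. s \<ge> 0 \<and> \<gamma> s = Pc"
  shows "filterlim sopt at_top at_top"
proof -
  have less: "\<gamma> x < Pc" if "x \<ge> 0" for x
  proof (rule ccontr)
    assume "\<not> \<gamma> x < Pc"
    moreover have "continuous_on {0..x} \<gamma>"
      by (rule continuous_on_subset[OF \<gamma>_continuous]) auto
    ultimately have "\<exists>s. 0 \<le> s \<and> s \<le> x \<and> \<gamma> s = Pc"
      using that Pc \<gamma>_0 by (intro IVT') auto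
    thus False using assms by blast
  qed
  have "eventually (\<lambda>G. Z < sopt G) at_top" for Z
    using opt_s_eventually_greater[of "max 0 Z"] less[of "max 0 Z"]
    by (auto elim: eventually_mono)
  thus ?thesis by (simp add: filterlim_at_top_dense)
qed

text \<open>
  If \<open>\<phi>\<close> is affine on an interval, \<open>\<gamma> s = Pc\<close> may have many solutions; the limit is the least one.
\<close>

lemma opt_s_tendsto_root:
  assumes "s \<ge> 0" "\<gamma> s = Pc"
  shows "\<exists>s2\<ge>0. \<gamma> s2 = Pc \<and> (sopt \<longlongrightarrow> s2) at_top"
proof -
  define S where "S = {0..} \<inter> \<gamma> -` {Pc}"
  have "closed S"
    unfolding S_def by (intro continuous_closed_preimage \<gamma>_continuous) auto
  moreover have "S \<noteq> {}" "bdd_below S" using assms by (auto simp: S_def)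
  ultimately have "Inf S \<in> S" by (intro closed_contains_Inf)
  define m where "m = Inf S"
  have m: "m \<ge> 0" "\<gamma> m = Pc" using \<open>Inf S \<in> S\<close> by (auto simp: S_def m_def)
  hence "m > 0" using \<gamma>_0 Pc by (cases "m = 0") auto
  have below: "\<gamma> x < Pc" if "0 \<le> x" "x < m" for x
  proof -
    have "x \<notin> S" using that cInf_lower[OF _ \<open>bdd_below S\<close>] by (fastforce simp: m_def)
    hence "\<gamma> x \<noteq> Pc" using that by (auto simp: S_def)
    thus ?thesis using \<gamma>_mono[of x m] that m by simp
  qed
  have "(sopt \<longlongrightarrow> m) at_top"
  proof (rule order_tendstoI)
    show "eventually (\<lambda>G. a < sopt G) at_top" if "a < m" for a
      \<comment> \<open>The maximum moves a negative \<open>a\<close> into the domain and stays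
        below \<open>m\<close> because \<open>m > 0\<close>.\<close>
      using opt_s_eventually_greater[of "max 0 a"] below[of "max 0 a"] that \<open>m > 0\<close>
      by (auto elim: eventually_mono)
    show "eventually (\<lambda>G. sopt G < a) at_top" if "m < a" for a
      using eventually_gt_at_top[of 0]
    proof eventually_elim
      case (elim G)
      \<comment> \<open>At \<open>m\<close> the terms \<open>\<gamma> m\<close> and
        \<open>Pc\<close> cancel, leaving \<open>c G * q_exp m\<close>; thus the optimum stays below
        \<open>m\<close> for every gain.\<close>
      have "h G m > 0"
        using m elim c_pos[of G] q_exp_pos[OF \<open>m > 0\<close>] by (simp add: h_def)
      thus ?case using opt_s_less_iff[of G m] elim m that by auto
    qed
  qed
  with m show ?thesis by blast
qed

end

text \<open>The limit at infinity is split into two cases because the equation for \<open>s2\<close>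
  can lack a solution, for instance when \<open>\<kappa> = 0\<close> or \<open>\<phi>\<close> is
  linear; the limit is then infinite.\<close>

theorem theorem5:
  fixes \<phi> :: "real \<Rightarrow> real" and \<kappa> B \<sigma> \<xi> Pc :: real
  assumes "B > 0" and "\<sigma> > 0" and "\<xi> > 0" and "Pc > 0" and "\<kappa> \<ge> 0"
    and "\<phi> 0 = 0"
    and "\<phi> differentiable_on {0..}"
    and "strict_mono_on {0..} \<phi>"
    and "convex_on {0..} \<phi>"
  shows "strict_antimono_on {0<..} (opt_energy \<phi> \<kappa> B \<sigma> \<xi> Pc)
    \<and> strict_mono_on {0<..} (opt_s \<phi> \<kappa> B \<sigma> \<xi> Pc)
    \<and> ((\<exists>s\<ge>0. \<kappa> * g_fun \<phi> (B * s) = Pc) \<longrightarrow>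
         (\<exists>s2\<ge>0. \<kappa> * g_fun \<phi> (B * s2) = Pc \<and>
            (opt_s \<phi> \<kappa> B \<sigma> \<xi> Pc \<longlongrightarrow> s2) at_top))
    \<and> ((\<nexists>s. s \<ge> 0 \<and> \<kappa> * g_fun \<phi> (B * s) = Pc) \<longrightarrow>
         filterlim (opt_s \<phi> \<kappa> B \<sigma> \<xi> Pc) at_top at_top)
    \<and> (opt_s \<phi> \<kappa> B \<sigma> \<xi> Pc \<longlongrightarrow> 0) (at_right 0)"
proof -
  interpret static_channel \<phi> \<kappa> B \<sigma> \<xi> Pc
    using assms by unfold_locales
  show ?thesis
    using opt_energy_strict_antimono opt_s_strict_mono opt_s_tendsto_root opt_s_at_top
      opt_s_tendsto_0
    unfolding \<gamma>_def by blast
qed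

end
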